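(* Let $(\mathcal{J},\cdot,\alpha)$ be a Hom-Jordan superalgebra and let $(V,\pi,\beta)$ be a $\mathcal{J}$-module. Then there exists a compatible Hom-pre-Jordan superalgebra structure on $\mathcal{J}$ if and only if there exists an invertible $\mathcal{O}$-operator $T:V\to\mathcal{J}$ associated to $(V,\pi,\beta)$. Furthermore, the compatible Hom-pre-Jordan superalgebra structure on $\mathcal{J}$ is given by $$x\circ y=T\big(\pi(x)T^{-1}(y)\big)\qquad\text{for all homogeneous } x,y\in\mathcal{J}.$$
   Context: $\mathbb{K}$ is an algebraically closed field of characteristic $0$; all spaces and linear maps are over $\mathbb{K}$. $|x|\in\mathbb{Z}_2$ is the parity of a homogeneous element $x$; identities involving parities are required for all homogeneous elements. A Hom-Jordan superalgebra is a triple $(\mathcal{J},\cdot,\alpha)$ with $\mathcal{J}$ a $\mathbb{Z}_2$-graded vector space, $\cdot:\mathcal{J}\times\mathcal{J}\to\mathcal{J}$ an even bilinear map with $x\cdot y=(-1)^{|x||y|}y\cdot x$, and $\alpha:\mathcal{J}\to\mathcal{J}$ an even linear map, such that for all homogeneous $x,y,z,u$ $$\sum_{x,y,u}(-1)^{|u|(|x|+|z|)}\,as_\alpha(x\cdot y,\alpha(z),\alpha(u))=0,$$ where $\sum_{x,y,u}$ is the cyclic sum over $(x,y,u)$ and $as_\alpha(x,y,z)=(x\cdot y)\cdot\alpha(z)-\alpha(x)\cdot(y\cdot z)$. All Hom-algebras are multiplicative: the twist map is a morphism for the products. A $\mathcal{J}$-module (representation) on a $\mathbb{Z}_2$-graded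 vector space $V$ with respect to an even linear map $\beta:V\to V$, written $(V,\pi,\beta)$, is an even linear map $\pi:\mathcal{J}\to \mathrm{End}(V)$ such that for all homogeneous $x,y,z$, $\beta\pi(x)=\pi(\alpha(x))\beta$ and $$(-1)^{|x||z|}\pi(\alpha(x)\cdot\alpha(y))\pi(\alpha(z))\beta+(-1)^{|x||y|}\pi(\alpha(y)\cdot\alpha(z))\pi(\alpha(x))\beta+(-1)^{|y||z|}\pi(\alpha(z)\cdot\alpha(x))\pi(\alpha(y))\beta$$ is equal to both of $$(-1)^{|x||z|}\pi(\alpha^2(x))\pi(y\cdot z)\beta+(-1)^{|x||y|}\pi(\alpha^2(y))\pi(z\cdot x)\beta+(-1)^{|y||z|}\pi(\alpha^2(z))\pi(x\cdot y)\beta$$ and $$(-1)^{|x||z|}\pi(\alpha^2(x))\pi(\alpha(y))\pi(z)+(-1)^{|x||y|+|y||z|}\pi(\alpha^2(z))\pi(\alpha(y))\pi(x)+(-1)^{|y||z|+|x||z|}\pi((x\cdot z)\cdot\alpha(y))\beta^2.$$ An $\mathcal{O}$-operator on $\mathcal{J}$ associated to $(V,\pi,\beta)$ is an even linear map $T:V\to\mathcal{J}$ with $\alpha T=T\beta$ and $T(u)\cdot T(v)=T\big(\pi(T(u))v+(-1)^{|u||v|}\pi(T(v))u\big)$ for all homogeneous $u,v\in V$. A Hom-pre-Jordan superalgebra is a triple $(\mathcal{A},\circ,\alpha)$ with $\mathcal{A}$ a $\mathbb{Z}_2$-graded vector space, $\circ$ an even bilinear product and $\alpha$ an even linear map (with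 $\alpha(x\circ y)=\alpha(x)\circ\alpha(y)$), such that, with $x\cdot y=x\circ y+(-1)^{|x||y|}y\circ x$, for all homogeneous $x,y,z,u$ both $$[\alpha(x)\cdot\alpha(y)]\circ[\alpha(z)\circ\alpha(u)]+(-1)^{|x|(|y|+|z|)}[\alpha(y)\cdot\alpha(z)]\circ[\alpha(x)\circ\alpha(u)]+(-1)^{|z|(|x|+|y|)}[\alpha(z)\cdot\alpha(x)]\circ[\alpha(y)\circ\alpha(u)]$$ and $$\alpha^2(x)\circ[\alpha(y)\circ(z\circ u)]+(-1)^{|z|(|x|+|y|)+|x||y|}\alpha^2(z)\circ[\alpha(y)\circ(x\circ u)]+(-1)^{|y||z|}[(x\cdot z)\cdot\alpha(y)]\circ\alpha^2(u)$$ are equal to $$\alpha^2(x)\circ[(y\cdot z)\circ\alpha(u)]+(-1)^{|x|(|y|+|z|)}\alpha^2(y)\circ[(z\cdot x)\circ\alpha(u)]+(-1)^{|z|(|x|+|y|)}\alpha^2(z)\circ[(x\cdot y)\circ\alpha(u)].$$ A compatible Hom-pre-Jordan superalgebra structure on a Hom-Jordan superalgebra $(\mathcal{J},\cdot,\alpha)$ is a product $\circ$ on $\mathcal{J}$ such that $(\mathcal{J},\circ,\alpha)$ is a Hom-pre-Jordan superalgebra and $x\cdot y=x\circ y+(-1)^{|x||y|}y\circ x$ for all homogeneous $x,y$.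
   Formalization: The "only if" half fails for a fixed module (V = 0, J nonzero with zero product), so the equivalence is stated with the module existentially quantified; the "if" half and the formula for the product hold for every given module V and every invertible O-operator. *)

theory Defs
  imports
    "HOL-Computational_Algebra.Polynomial"
    "HOL-Library.Z2"
begin

text \<open>
  Parities are elements of the two-element field \<^typ>\<open>bit\<close>. The zero vector is homogeneous of both
  parities, so parities are carried as explicit indices: \<open>x \<in> G i\<close> reads ``\<open>x\<close> is homogeneous
  with \<open>|x| = i\<close>''. The exponents of \<open>-1\<close> below are sums of products of such parities,
  evaluated in \<^typ>\<open>bit\<close>.
\<close>

definition koszul :: "bit \<Rightarrow> 'k::ring_1" where
  "koszul i = (if i = 0 then 1 else - 1)"

locale graded_space = vector_space scale
  for scale :: "'k::field \<Rightarrow> 'v::ab_group_add \<Rightarrow> 'v" +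
  fixes G :: "bit \<Rightarrow> 'v set"
  assumes subspace_G: "subspace (G i)"
    and G_inter: "G 0 \<inter> G 1 = {0}"
    and G_sum: "\<exists>a\<in>G 0. \<exists>b\<in>G 1. x = a + b"

definition even_linear ::
  "('k::field \<Rightarrow> 'v::ab_group_add \<Rightarrow> 'v) \<Rightarrow> (bit \<Rightarrow> 'v set) \<Rightarrow>
   ('k \<Rightarrow> 'w::ab_group_add \<Rightarrow> 'w) \<Rightarrow> (bit \<Rightarrow> 'w set) \<Rightarrow> ('v \<Rightarrow> 'w) \<Rightarrow> bool" where
  "even_linear scaleV V scaleW W f \<longleftrightarrow>
     Vector_Spaces.linear scaleV scaleW f \<and> (\<forall>i. \<forall>x\<in>V i. f x \<in> W i)"

text \<open>
  An even linear map \<open>U \<rightarrow> End(V)\<close>, where \<open>End(V)\<close> is graded by the degree of endomorphisms, is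
  the same as an even bilinear map \<open>U \<times> V \<rightarrow> V\<close> in curried form.
\<close>

definition even_bilinear ::
  "('k::field \<Rightarrow> 'u::ab_group_add \<Rightarrow> 'u) \<Rightarrow> (bit \<Rightarrow> 'u set) \<Rightarrow>
   ('k \<Rightarrow> 'v::ab_group_add \<Rightarrow> 'v) \<Rightarrow> (bit \<Rightarrow> 'v set) \<Rightarrow>
   ('k \<Rightarrow> 'w::ab_group_add \<Rightarrow> 'w) \<Rightarrow> (bit \<Rightarrow> 'w set) \<Rightarrow> ('u \<Rightarrow> 'v \<Rightarrow> 'w) \<Rightarrow> bool" where
  "even_bilinear scaleU U scaleV V scaleW W b \<longleftrightarrow>
     (\<forall>x. Vector_Spaces.linear scaleV scaleW (\<lambda>y. b x y)) \<and>
     (\<forall>y. Vector_Spaces.linear scaleU scaleW (\<lambda>x. b x y)) \<and>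
     (\<forall>i j. \<forall>x\<in>U i. \<forall>y\<in>V j. b x y \<in> W (i + j))"

definition hom_associator ::
  "('v \<Rightarrow> 'v \<Rightarrow> 'v::ab_group_add) \<Rightarrow> ('v \<Rightarrow> 'v) \<Rightarrow> 'v \<Rightarrow> 'v \<Rightarrow> 'v \<Rightarrow> 'v" where
  "hom_associator mul \<alpha> x y z = mul (mul x y) (\<alpha> z) - mul (\<alpha> x) (mul y z)"

locale hom_jordan_superalgebra = graded_space scale G
  for scale :: "'k::field \<Rightarrow> 'j::ab_group_add \<Rightarrow> 'j" and G :: "bit \<Rightarrow> 'j set" +
  fixes mul :: "'j \<Rightarrow> 'j \<Rightarrow> 'j" and \<alpha> :: "'j \<Rightarrow> 'j"
  assumes even_bilinear_mul: "even_bilinear scale G scale G scale G mul"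
    and even_linear_twist: "even_linear scale G scale G \<alpha>"
    and multiplicative: "\<alpha> (mul x y) = mul (\<alpha> x) (\<alpha> y)"
    and supercommutative:
      "\<lbrakk>x \<in> G i; y \<in> G j\<rbrakk> \<Longrightarrow> mul x y = scale (koszul (i * j)) (mul y x)"
    and hom_jordan_identity:
      "\<lbrakk>x \<in> G i; y \<in> G j; z \<in> G k; u \<in> G l\<rbrakk> \<Longrightarrow>
         scale (koszul (l * (i + k))) (hom_associator mul \<alpha> (mul x y) (\<alpha> z) (\<alpha> u))
       + scale (koszul (i * (j + k))) (hom_associator mul \<alpha> (mul y u) (\<alpha> z) (\<alpha> x))
       + scale (koszul (j * (l + k))) (hom_associator mul \<alpha> (mul u x) (\<alpha> z) (\<alpha> y)) = 0"

locale hom_jordan_module =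
  J: hom_jordan_superalgebra scaleJ J mul \<alpha> + V: graded_space scaleV V
  for scaleJ :: "'k::field \<Rightarrow> 'j::ab_group_add \<Rightarrow> 'j" and J :: "bit \<Rightarrow> 'j set"
    and mul :: "'j \<Rightarrow> 'j \<Rightarrow> 'j" and \<alpha> :: "'j \<Rightarrow> 'j"
    and scaleV :: "'k \<Rightarrow> 'v::ab_group_add \<Rightarrow> 'v" and V :: "bit \<Rightarrow> 'v set" +
  fixes \<pi> :: "'j \<Rightarrow> 'v \<Rightarrow> 'v" and \<beta> :: "'v \<Rightarrow> 'v"
  assumes even_bilinear_action: "even_bilinear scaleJ J scaleV V scaleV V \<pi>"
    and even_linear_beta: "even_linear scaleV V scaleV V \<beta>"
    and beta_action: "x \<in> J i \<Longrightarrow> \<beta> (\<pi> x v) = \<pi> (\<alpha> x) (\<beta> v)"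
    and module_identity1:
      "\<lbrakk>x \<in> J i; y \<in> J j; z \<in> J k\<rbrakk> \<Longrightarrow>
         scaleV (koszul (i * k)) (\<pi> (mul (\<alpha> x) (\<alpha> y)) (\<pi> (\<alpha> z) (\<beta> v)))
       + scaleV (koszul (i * j)) (\<pi> (mul (\<alpha> y) (\<alpha> z)) (\<pi> (\<alpha> x) (\<beta> v)))
       + scaleV (koszul (j * k)) (\<pi> (mul (\<alpha> z) (\<alpha> x)) (\<pi> (\<alpha> y) (\<beta> v)))
       = scaleV (koszul (i * k)) (\<pi> (\<alpha> (\<alpha> x)) (\<pi> (mul y z) (\<beta> v)))
       + scaleV (koszul (i * j)) (\<pi> (\<alpha> (\<alpha> y)) (\<pi> (mul z x) (\<beta> v)))
       + scaleV (koszul (j * k)) (\<pi> (\<alpha> (\<alpha> z)) (\<pi> (mul x y) (\<beta> v)))"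
    and module_identity2:
      "\<lbrakk>x \<in> J i; y \<in> J j; z \<in> J k\<rbrakk> \<Longrightarrow>
         scaleV (koszul (i * k)) (\<pi> (mul (\<alpha> x) (\<alpha> y)) (\<pi> (\<alpha> z) (\<beta> v)))
       + scaleV (koszul (i * j)) (\<pi> (mul (\<alpha> y) (\<alpha> z)) (\<pi> (\<alpha> x) (\<beta> v)))
       + scaleV (koszul (j * k)) (\<pi> (mul (\<alpha> z) (\<alpha> x)) (\<pi> (\<alpha> y) (\<beta> v)))
       = scaleV (koszul (i * k)) (\<pi> (\<alpha> (\<alpha> x)) (\<pi> (\<alpha> y) (\<pi> z v)))
       + scaleV (koszul (i * j + j * k)) (\<pi> (\<alpha> (\<alpha> z)) (\<pi> (\<alpha> y) (\<pi> x v)))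
       + scaleV (koszul (j * k + i * k)) (\<pi> (mul (mul x z) (\<alpha> y)) (\<beta> (\<beta> v)))"

definition O_operator ::
  "('k::field \<Rightarrow> 'j::ab_group_add \<Rightarrow> 'j) \<Rightarrow> (bit \<Rightarrow> 'j set) \<Rightarrow> ('j \<Rightarrow> 'j \<Rightarrow> 'j) \<Rightarrow> ('j \<Rightarrow> 'j) \<Rightarrow>
   ('k \<Rightarrow> 'v::ab_group_add \<Rightarrow> 'v) \<Rightarrow> (bit \<Rightarrow> 'v set) \<Rightarrow> ('j \<Rightarrow> 'v \<Rightarrow> 'v) \<Rightarrow> ('v \<Rightarrow> 'v) \<Rightarrow>
   ('v \<Rightarrow> 'j) \<Rightarrow> bool" where
  "O_operator scaleJ J mul \<alpha> scaleV V \<pi> \<beta> T \<longleftrightarrow>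
     even_linear scaleV V scaleJ J T \<and>
     (\<forall>v. \<alpha> (T v) = T (\<beta> v)) \<and>
     (\<forall>i j. \<forall>u\<in>V i. \<forall>v\<in>V j.
        mul (T u) (T v) = T (\<pi> (T u) v + scaleV (koszul (i * j)) (\<pi> (T v) u)))"

text \<open>
  The product \<open>x \<cdot> y = x \<circ> y + (-1)\<^bsup>|x||y|\<^esup> y \<circ> x\<close> of homogeneous elements \<open>x\<close>, \<open>y\<close> with
  \<open>|x| = i\<close> and \<open>|y| = j\<close>.
\<close>

definition super_sym_prod ::
  "('k::field \<Rightarrow> 'a::ab_group_add \<Rightarrow> 'a) \<Rightarrow> ('a \<Rightarrow> 'a \<Rightarrow> 'a) \<Rightarrow> bit \<Rightarrow> bit \<Rightarrow> 'a \<Rightarrow> 'a \<Rightarrow> 'a" where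
  "super_sym_prod scale circ i j x y = circ x y + scale (koszul (i * j)) (circ y x)"

locale hom_pre_jordan_superalgebra = graded_space scale G
  for scale :: "'k::field \<Rightarrow> 'a::ab_group_add \<Rightarrow> 'a" and G :: "bit \<Rightarrow> 'a set" +
  fixes circ :: "'a \<Rightarrow> 'a \<Rightarrow> 'a" and \<alpha> :: "'a \<Rightarrow> 'a"
  assumes even_bilinear_circ: "even_bilinear scale G scale G scale G circ"
    and even_linear_twist: "even_linear scale G scale G \<alpha>"
    and multiplicative: "\<alpha> (circ x y) = circ (\<alpha> x) (\<alpha> y)"
    and pre_jordan_identity1:
      "\<lbrakk>x \<in> G i; y \<in> G j; z \<in> G k; u \<in> G l\<rbrakk> \<Longrightarrow>
         circ (super_sym_prod scale circ i j (\<alpha> x) (\<alpha> y)) (circ (\<alpha> z) (\<alpha> u))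
       + scale (koszul (i * (j + k)))
           (circ (super_sym_prod scale circ j k (\<alpha> y) (\<alpha> z)) (circ (\<alpha> x) (\<alpha> u)))
       + scale (koszul (k * (i + j)))
           (circ (super_sym_prod scale circ k i (\<alpha> z) (\<alpha> x)) (circ (\<alpha> y) (\<alpha> u)))
       = circ (\<alpha> (\<alpha> x)) (circ (super_sym_prod scale circ j k y z) (\<alpha> u))
       + scale (koszul (i * (j + k)))
           (circ (\<alpha> (\<alpha> y)) (circ (super_sym_prod scale circ k i z x) (\<alpha> u)))
       + scale (koszul (k * (i + j)))
           (circ (\<alpha> (\<alpha> z)) (circ (super_sym_prod scale circ i j x y) (\<alpha> u)))"
    and pre_jordan_identity2:
      "\<lbrakk>x \<in> G i; y \<in> G j; z \<in> G k; u \<in> G l\<rbrakk> \<Longrightarrow>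
         circ (\<alpha> (\<alpha> x)) (circ (\<alpha> y) (circ z u))
       + scale (koszul (k * (i + j) + i * j)) (circ (\<alpha> (\<alpha> z)) (circ (\<alpha> y) (circ x u)))
       + scale (koszul (j * k))
           (circ (super_sym_prod scale circ (i + k) j (super_sym_prod scale circ i k x z) (\<alpha> y))
              (\<alpha> (\<alpha> u)))
       = circ (\<alpha> (\<alpha> x)) (circ (super_sym_prod scale circ j k y z) (\<alpha> u))
       + scale (koszul (i * (j + k)))
           (circ (\<alpha> (\<alpha> y)) (circ (super_sym_prod scale circ k i z x) (\<alpha> u)))
       + scale (koszul (k * (i + j)))
           (circ (\<alpha> (\<alpha> z)) (circ (super_sym_prod scale circ i j x y) (\<alpha> u)))"

definition compatible_hom_pre_jordan ::
  "('k::field \<Rightarrow> 'j::ab_group_add \<Rightarrow> 'j) \<Rightarrow> (bit \<Rightarrow> 'j set) \<Rightarrow> ('j \<Rightarrow> 'j \<Rightarrow> 'j) \<Rightarrow> ('j \<Rightarrow> 'j) \<Rightarrow>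
   ('j \<Rightarrow> 'j \<Rightarrow> 'j) \<Rightarrow> bool" where
  "compatible_hom_pre_jordan scale J mul \<alpha> circ \<longleftrightarrow>
     hom_pre_jordan_superalgebra scale J circ \<alpha> \<and>
     (\<forall>i j. \<forall>x\<in>J i. \<forall>y\<in>J j. mul x y = super_sym_prod scale circ i j x y)"

end

theory Submission
  imports Defs
begin

text \<open>
  Both the axioms of a module and those of a Hom-pre-Jordan superalgebra are equations between
  operators built from left multiplications. Written with \<open>\<pi>(x) = x \<circ> _\<close> and \<open>\<beta> = \<alpha>\<close>, the
  three-term expressions of the module axioms are \<open>(-1)\<^bsup>|x||z|\<^esup>\<close> times the corresponding
  expressions of the pre-Jordan axioms (lemmas \<open>koszul_cyclic_sum\<close> and \<open>koszul_triple_sum\<close>),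
  so the two sets of axioms say the same thing.

  Hence, if \<open>\<circ>\<close> is compatible, then \<open>\<J>\<close> acts on itself by left multiplication, and the
  compatibility condition is exactly the statement that the identity is an \<open>\<O>\<close>-operator for
  this action. Conversely, an invertible \<open>\<O>\<close>-operator \<open>T\<close> is an isomorphism from \<open>V\<close> to \<open>\<J>\<close>
  that turns \<open>\<beta>\<close> into \<open>\<alpha>\<close>; carrying the action along \<open>T\<close> gives the action
  \<open>x \<circ> y = T (\<pi> x (T\<^sup>-\<^sup>1 y))\<close> of \<open>\<J>\<close> on itself, for which the \<open>\<O>\<close>-operator equation becomes
  compatibility, and the module axioms become the pre-Jordan axioms.

  The remaining work lies in the grading: some axioms are given for homogeneous arguments only
  and are extended by additivity (\<open>homogeneous_induct\<close>), and \<open>T\<^sup>-\<^sup>1\<close> has to be shown to be even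
  (\<open>even_linear_injective_reflects_degree\<close>).
\<close>

context vector_space
begin

text \<open>
  The two lemmas below pass between the sign convention of the module axioms on the left and that
  of the pre-Jordan axioms on the right.
\<close>

lemma koszul_cyclic_sum:
  "scale (koszul (i * k)) a + scale (koszul (i * j)) b + scale (koszul (j * k)) c
   = scale (koszul (i * k))
       (a + scale (koszul (i * (j + k))) b + scale (koszul (k * (i + j))) c)"
  by (cases i; cases j; cases k) (simp_all add: koszul_def algebra_simps)

lemma koszul_triple_sum:
  "scale (koszul (i * k)) a + scale (koszul (i * j + j * k)) b + scale (koszul (j * k + i * k)) c
   = scale (koszul (i * k))
       (a + scale (koszul (k * (i + j) + i * j)) b + scale (koszul (j * k)) c)"
  by (cases i; cases j; cases k) (simp_all add: koszul_def algebra_simps)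

lemma scale_koszul_cancel: "scale (koszul i) a = scale (koszul i) b \<longleftrightarrow> a = b"
  by (simp add: koszul_def)

end

lemma (in graded_space) homogeneous_induct [case_names homogeneous add]:
  assumes "\<And>i x. x \<in> G i \<Longrightarrow> P x" and "\<And>x y. P x \<Longrightarrow> P y \<Longrightarrow> P (x + y)"
  shows "P x"
  using G_sum[of x] assms by metis

text \<open>
  If \<open>T (a + b)\<close> is homogeneous with \<open>a\<close> even and \<open>b\<close> odd, then the component of \<open>T a + T b\<close> in
  the other degree vanishes, and injectivity removes the corresponding summand of \<open>a + b\<close>.
\<close>

lemma even_linear_injective_reflects_degree:
  assumes V: "graded_space scaleV V" and W: "graded_space scaleW W"
    and T: "even_linear scaleV V scaleW W T" and inj: "inj T"
    and Tv: "T v \<in> W i"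
  shows "v \<in> V i"
proof -
  interpret V: graded_space scaleV V by (fact V)
  interpret W: graded_space scaleW W by (fact W)
  interpret T: Vector_Spaces.linear scaleV scaleW T
    using T by (simp add: even_linear_def)
  have deg: "x \<in> V j \<Longrightarrow> T x \<in> W j" for x j
    using T by (simp add: even_linear_def)
  obtain a b where a: "a \<in> V 0" and b: "b \<in> V 1" and v: "v = a + b"
    using V.G_sum by blast
  have zero: "x = 0" if "T x \<in> W 0" "T x \<in> W 1" for x
  proof -
    have "T x = T 0" using that W.G_inter T.zero by auto
    then show ?thesis using inj by (blast dest: injD)
  qed
  consider "i = 0" | "i = 1"
    by (cases i) auto
  then show ?thesis
  proof cases
    case 1
    have "T b = T v - T a" using v by (simp add: T.add)
    then have "T b \<in> W 0" using Tv 1 deg[OF a] W.subspace_diff[OF W.subspace_G] by simp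
    then have "b = 0" using zero deg[OF b] by blast
    then show ?thesis using v a 1 by simp
  next
    case 2
    have "T a = T v - T b" using v by (simp add: T.add)
    then have "T a \<in> W 1" using Tv 2 deg[OF b] W.subspace_diff[OF W.subspace_G] by simp
    then have "a = 0" using zero deg[OF a] by blast
    then show ?thesis using v b 2 by simp
  qed
qed

text \<open>
  The identity is a witness for \<open>T\<close> because the \<open>\<O>\<close>-operator equation for it is the
  decomposition of the product of \<open>\<J>\<close> required by compatibility.
\<close>

lemma compatible_imp_left_multiplication_module:
  assumes J: "hom_jordan_superalgebra scale J mul \<alpha>"
    and comp: "compatible_hom_pre_jordan scale J mul \<alpha> circ"
  shows "hom_jordan_module scale J mul \<alpha> scale J circ \<alpha>"
    and "O_operator scale J mul \<alpha> scale J circ \<alpha> id"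
proof -
  interpret J: hom_jordan_superalgebra scale J mul \<alpha> by (fact J)
  interpret P: hom_pre_jordan_superalgebra scale J circ \<alpha>
    using comp by (simp add: compatible_hom_pre_jordan_def)
  have mul: "super_sym_prod scale circ i j x y = mul x y" if "x \<in> J i" "y \<in> J j" for i j x y
    using comp that by (simp add: compatible_hom_pre_jordan_def)
  have mul_deg: "mul x y \<in> J (i + j)" if "x \<in> J i" "y \<in> J j" for i j x y
    using J.even_bilinear_mul that by (simp add: even_bilinear_def)
  have \<alpha>_deg: "\<alpha> x \<in> J i" if "x \<in> J i" for i x
    using J.even_linear_twist that by (simp add: even_linear_def)
  interpret \<alpha>: Vector_Spaces.linear scale scale \<alpha>
    using J.even_linear_twist by (simp add: even_linear_def)
  have circ_add: "circ x (u + v) = circ x u + circ x v" for x u v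
    using P.even_bilinear_circ
    by (simp add: even_bilinear_def Vector_Spaces.linear_iff)
  note additive = \<alpha>.add circ_add J.scale_right_distrib
  \<comment> \<open>Only the listed rules are used to simplify: the default ones evaluate degrees such as \<open>i + k\<close> by
    cases, after which the two sides no longer match.\<close>
  note degs = mul mul_deg \<alpha>_deg
  have identity1:
    "circ (mul (\<alpha> x) (\<alpha> y)) (circ (\<alpha> z) (\<alpha> v))
     + scale (koszul (i * (j + k))) (circ (mul (\<alpha> y) (\<alpha> z)) (circ (\<alpha> x) (\<alpha> v)))
     + scale (koszul (k * (i + j))) (circ (mul (\<alpha> z) (\<alpha> x)) (circ (\<alpha> y) (\<alpha> v)))
     = circ (\<alpha> (\<alpha> x)) (circ (mul y z) (\<alpha> v))
     + scale (koszul (i * (j + k))) (circ (\<alpha> (\<alpha> y)) (circ (mul z x) (\<alpha> v)))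
     + scale (koszul (k * (i + j))) (circ (\<alpha> (\<alpha> z)) (circ (mul x y) (\<alpha> v)))"
    (is "?L v = ?R v")
    if xyz: "x \<in> J i" "y \<in> J j" "z \<in> J k" for i j k x y z v
  proof (induction v rule: J.homogeneous_induct)
    case (homogeneous l v)
    then show ?case using P.pre_jordan_identity1[OF xyz homogeneous] xyz by (simp only: degs)
  next
    case (add u v)
    have "?L (u + v) = ?L u + ?L v" "?R (u + v) = ?R u + ?R v"
      by (simp_all only: additive ac_simps)
    then show ?case using add by simp
  qed
  have identity2:
    "circ (\<alpha> (\<alpha> x)) (circ (\<alpha> y) (circ z v))
     + scale (koszul (k * (i + j) + i * j)) (circ (\<alpha> (\<alpha> z)) (circ (\<alpha> y) (circ x v)))
     + scale (koszul (j * k)) (circ (mul (mul x z) (\<alpha> y)) (\<alpha> (\<alpha> v)))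
     = circ (\<alpha> (\<alpha> x)) (circ (mul y z) (\<alpha> v))
     + scale (koszul (i * (j + k))) (circ (\<alpha> (\<alpha> y)) (circ (mul z x) (\<alpha> v)))
     + scale (koszul (k * (i + j))) (circ (\<alpha> (\<alpha> z)) (circ (mul x y) (\<alpha> v)))"
    (is "?L v = ?R v")
    if xyz: "x \<in> J i" "y \<in> J j" "z \<in> J k" for i j k x y z v
  proof (induction v rule: J.homogeneous_induct)
    case (homogeneous l v)
    then show ?case using P.pre_jordan_identity2[OF xyz homogeneous] xyz by (simp only: degs)
  next
    case (add u v)
    have "?L (u + v) = ?L u + ?L v" "?R (u + v) = ?R u + ?R v"
      by (simp_all only: additive ac_simps)
    then show ?case using add by simp
  qed
  show "hom_jordan_module scale J mul \<alpha> scale J circ \<alpha>"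
  proof unfold_locales
    show "even_bilinear scale J scale J scale J circ" by (fact P.even_bilinear_circ)
    show "even_linear scale J scale J \<alpha>" by (fact J.even_linear_twist)
    show "\<alpha> (circ x v) = circ (\<alpha> x) (\<alpha> v)" for x v by (fact P.multiplicative)
  qed (simp_all only: J.koszul_cyclic_sum J.koszul_triple_sum J.scale_koszul_cancel
         identity1 identity2)
  have "mul u v = circ u v + scale (koszul (i * j)) (circ v u)" if "u \<in> J i" "v \<in> J j" for i j u v
    using mul[OF that] by (simp only: super_sym_prod_def)
  then show "O_operator scale J mul \<alpha> scale J circ \<alpha> id"
    unfolding O_operator_def even_linear_def by (metis J.linear_id id_apply)
qed

text \<open>
  Since \<open>T\<^sup>-\<^sup>1 (x \<circ> y) = \<pi> x (T\<^sup>-\<^sup>1 y)\<close>, a nested product \<open>x \<circ> (y \<circ> u)\<close> is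
  \<open>T (\<pi> x (\<pi> y (T\<^sup>-\<^sup>1 u)))\<close>. Each pre-Jordan identity at \<open>u\<close> is therefore the image under \<open>T\<close> of a
  module identity at \<open>T\<^sup>-\<^sup>1 u\<close>.
\<close>

lemma invertible_O_operator_imp_compatible:
  assumes M: "hom_jordan_module scaleJ J mul \<alpha> scaleV V \<pi> \<beta>"
    and O: "O_operator scaleJ J mul \<alpha> scaleV V \<pi> \<beta> T" and bij: "bij T"
  shows "compatible_hom_pre_jordan scaleJ J mul \<alpha> (\<lambda>x y. T (\<pi> x (inv T y)))"
proof -
  interpret M: hom_jordan_module scaleJ J mul \<alpha> scaleV V \<pi> \<beta> by (fact M)
  let ?c = "\<lambda>x y. T (\<pi> x (inv T y))"
  have T: "even_linear scaleV V scaleJ J T" and \<alpha>T: "\<alpha> (T v) = T (\<beta> v)" for v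
    using O by (simp_all add: O_operator_def)
  interpret T: Vector_Spaces.linear scaleV scaleJ T
    using T by (simp add: even_linear_def)
  interpret S: Vector_Spaces.linear scaleJ scaleV "inv T"
    using bij_module_hom_imp_inv_module_hom[OF T.module_hom_axioms bij]
    by (intro Vector_Spaces.linear.intro M.J.vector_space_axioms M.V.vector_space_axioms)
  have TS: "T (inv T x) = x" and ST: "inv T (T v) = v" for x v
    using bij by (simp_all add: bij_is_surj surj_f_inv_f bij_is_inj)
  have T_deg: "T v \<in> J i" if "v \<in> V i" for v i
    using T that by (simp add: even_linear_def)
  have S_deg: "inv T x \<in> V i" if "x \<in> J i" for x i
    using even_linear_injective_reflects_degree
      [OF M.V.graded_space_axioms M.J.graded_space_axioms T bij_is_inj[OF bij]]
      that by (simp add: TS)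
  have S\<alpha>: "inv T (\<alpha> x) = \<beta> (inv T x)" for x
    using \<alpha>T[of "inv T x"] by (metis TS ST)
  have \<pi>_lin: "Vector_Spaces.linear scaleV scaleV (\<pi> x)"
    "Vector_Spaces.linear scaleJ scaleV (\<lambda>x. \<pi> x v)"
    and \<pi>_deg: "x \<in> J i \<Longrightarrow> v \<in> V j \<Longrightarrow> \<pi> x v \<in> V (i + j)" for x v i j
    using M.even_bilinear_action by (simp_all add: even_bilinear_def)
  have mul_deg: "mul x y \<in> J (i + j)" if "x \<in> J i" "y \<in> J j" for i j x y
    using M.J.even_bilinear_mul that by (simp add: even_bilinear_def)
  have \<alpha>_deg: "\<alpha> x \<in> J i" if "x \<in> J i" for i x
    using M.J.even_linear_twist that by (simp add: even_linear_def)
  interpret \<alpha>: Vector_Spaces.linear scaleJ scaleJ \<alpha>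
    using M.J.even_linear_twist by (simp add: even_linear_def)
  interpret \<beta>: Vector_Spaces.linear scaleV scaleV \<beta>
    using M.even_linear_beta by (simp add: even_linear_def)

  have mul: "super_sym_prod scaleJ ?c i j x y = mul x y" if "x \<in> J i" "y \<in> J j" for i j x y
  proof -
    have "mul (T (inv T x)) (T (inv T y))
        = T (\<pi> (T (inv T x)) (inv T y) + scaleV (koszul (i * j)) (\<pi> (T (inv T y)) (inv T x)))"
      using O S_deg[OF that(1)] S_deg[OF that(2)] unfolding O_operator_def by blast
    then show ?thesis by (simp add: TS super_sym_prod_def T.add T.scale)
  qed
  have beta_action: "\<beta> (\<pi> x v) = \<pi> (\<alpha> x) (\<beta> v)" for x v
  proof (induction x rule: M.J.homogeneous_induct)
    case (homogeneous i x)
    then show ?case by (rule M.beta_action)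
  next
    case (add x y)
    then show ?case using \<pi>_lin(2)
      by (simp add: Vector_Spaces.linear_iff \<alpha>.add \<beta>.add)
  qed
  note degs = mul mul_deg \<alpha>_deg
  note module_identities =
    M.module_identity1 [unfolded M.V.koszul_cyclic_sum M.V.scale_koszul_cancel]
    M.module_identity2 [unfolded M.V.koszul_cyclic_sum M.V.koszul_triple_sum
      M.V.scale_koszul_cancel]
  have "hom_pre_jordan_superalgebra scaleJ J ?c \<alpha>"
  proof unfold_locales
    show "even_bilinear scaleJ J scaleJ J scaleJ J ?c"
      unfolding even_bilinear_def
    proof (intro conjI allI ballI)
      show "Vector_Spaces.linear scaleJ scaleJ (?c x)" for x
        using \<pi>_lin(1)[of x]
        by unfold_locales (simp_all add: Vector_Spaces.linear_iff T.add T.scale S.add S.scale)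
      show "Vector_Spaces.linear scaleJ scaleJ (\<lambda>x. ?c x y)" for y
        using \<pi>_lin(2)[of "inv T y"]
        by unfold_locales (simp_all add: Vector_Spaces.linear_iff T.add T.scale)
      show "?c x y \<in> J (i + j)" if "x \<in> J i" "y \<in> J j" for i j x y
        using that by (intro T_deg \<pi>_deg S_deg)
    qed
    show "even_linear scaleJ J scaleJ J \<alpha>" by (fact M.J.even_linear_twist)
    show "\<alpha> (?c x y) = ?c (\<alpha> x) (\<alpha> y)" for x y
      by (simp add: \<alpha>T beta_action S\<alpha>)
  next
    fix x i y j z k and u l
    assume xyz: "x \<in> J i" "y \<in> J j" "z \<in> J k"
    show "?c (super_sym_prod scaleJ ?c i j (\<alpha> x) (\<alpha> y)) (?c (\<alpha> z) (\<alpha> u))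
       + scaleJ (koszul (i * (j + k)))
           (?c (super_sym_prod scaleJ ?c j k (\<alpha> y) (\<alpha> z)) (?c (\<alpha> x) (\<alpha> u)))
       + scaleJ (koszul (k * (i + j)))
           (?c (super_sym_prod scaleJ ?c k i (\<alpha> z) (\<alpha> x)) (?c (\<alpha> y) (\<alpha> u)))
       = ?c (\<alpha> (\<alpha> x)) (?c (super_sym_prod scaleJ ?c j k y z) (\<alpha> u))
       + scaleJ (koszul (i * (j + k)))
           (?c (\<alpha> (\<alpha> y)) (?c (super_sym_prod scaleJ ?c k i z x) (\<alpha> u)))
       + scaleJ (koszul (k * (i + j)))
           (?c (\<alpha> (\<alpha> z)) (?c (super_sym_prod scaleJ ?c i j x y) (\<alpha> u)))"
      using arg_cong[OF module_identities(1)[OF xyz, of "inv T u"], of T] xyz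
      by (simp only: degs ST S\<alpha> T.add T.scale)
    show "?c (\<alpha> (\<alpha> x)) (?c (\<alpha> y) (?c z u))
       + scaleJ (koszul (k * (i + j) + i * j)) (?c (\<alpha> (\<alpha> z)) (?c (\<alpha> y) (?c x u)))
       + scaleJ (koszul (j * k))
           (?c (super_sym_prod scaleJ ?c (i + k) j (super_sym_prod scaleJ ?c i k x z) (\<alpha> y))
              (\<alpha> (\<alpha> u)))
       = ?c (\<alpha> (\<alpha> x)) (?c (super_sym_prod scaleJ ?c j k y z) (\<alpha> u))
       + scaleJ (koszul (i * (j + k)))
           (?c (\<alpha> (\<alpha> y)) (?c (super_sym_prod scaleJ ?c k i z x) (\<alpha> u)))
       + scaleJ (koszul (k * (i + j)))
           (?c (\<alpha> (\<alpha> z)) (?c (super_sym_prod scaleJ ?c i j x y) (\<alpha> u)))"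
      using arg_cong[OF trans[OF module_identities(2)[OF xyz, of "inv T u", symmetric]
          module_identities(1)[OF xyz, of "inv T u"]], of T] xyz
      by (simp only: degs ST S\<alpha> T.add T.scale)
  qed
  then show ?thesis
    by (simp add: compatible_hom_pre_jordan_def mul)
qed

theorem proposition4p10:
  fixes scaleJ :: "'k::{alg_closed_field, field_char_0} \<Rightarrow> 'j::ab_group_add \<Rightarrow> 'j"
    and J :: "bit \<Rightarrow> 'j set" and mul :: "'j \<Rightarrow> 'j \<Rightarrow> 'j" and \<alpha> :: "'j \<Rightarrow> 'j"
  assumes "hom_jordan_superalgebra scaleJ J mul \<alpha>"
  shows "((\<exists>circ. compatible_hom_pre_jordan scaleJ J mul \<alpha> circ) \<longleftrightarrow>
          (\<exists>(scaleV :: 'k \<Rightarrow> 'j \<Rightarrow> 'j) V \<pi> \<beta> T.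
             hom_jordan_module scaleJ J mul \<alpha> scaleV V \<pi> \<beta> \<and>
             O_operator scaleJ J mul \<alpha> scaleV V \<pi> \<beta> T \<and> bij T)) \<and>
         (\<forall>(scaleV :: 'k \<Rightarrow> 'v::ab_group_add \<Rightarrow> 'v) V \<pi> \<beta> T.
            hom_jordan_module scaleJ J mul \<alpha> scaleV V \<pi> \<beta> \<longrightarrow>
            O_operator scaleJ J mul \<alpha> scaleV V \<pi> \<beta> T \<longrightarrow> bij T \<longrightarrow>
            compatible_hom_pre_jordan scaleJ J mul \<alpha> (\<lambda>x y. T (\<pi> x (inv T y))))"
proof (intro conjI iffI allI impI)
  assume "\<exists>circ. compatible_hom_pre_jordan scaleJ J mul \<alpha> circ"
  then obtain circ where "compatible_hom_pre_jordan scaleJ J mul \<alpha> circ" by blast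
  from compatible_imp_left_multiplication_module[OF assms this] bij_id
  show "\<exists>(scaleV :: 'k \<Rightarrow> 'j \<Rightarrow> 'j) V \<pi> \<beta> T.
      hom_jordan_module scaleJ J mul \<alpha> scaleV V \<pi> \<beta> \<and>
      O_operator scaleJ J mul \<alpha> scaleV V \<pi> \<beta> T \<and> bij T"
    by blast
next
  assume "\<exists>(scaleV :: 'k \<Rightarrow> 'j \<Rightarrow> 'j) V \<pi> \<beta> T.
      hom_jordan_module scaleJ J mul \<alpha> scaleV V \<pi> \<beta> \<and>
      O_operator scaleJ J mul \<alpha> scaleV V \<pi> \<beta> T \<and> bij T"
  then show "\<exists>circ. compatible_hom_pre_jordan scaleJ J mul \<alpha> circ"
    by (blast intro: invertible_O_operator_imp_compatible)
qed (rule invertible_O_operator_imp_compatible)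

end
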